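(* For every integer $n\ge 0$, there is a one-to-one correspondence between the set of bicolored plane trees with $n$ edges and the set of free Dyck paths of length $2n$.
   Context: A plane tree is a rooted tree in which the children of each vertex are linearly ordered. A bicolored plane tree is a plane tree in which each child of the root is colored with one of two colors (black or white); no other vertices are colored. A free Dyck path of length $2n$ is a lattice path from $(0,0)$ to $(2n,0)$ consisting of $n$ up steps $(1,1)$ and $n$ down steps $(1,-1)$, with no further restriction. *)

theory Defs
  imports Main "HOL-Library.Product_Plus"
begin

datatype plane_tree = Node (children: "plane_tree list")

fun edges :: "plane_tree \<Rightarrow> nat" where
  "edges (Node ts) = (\<Sum>t\<leftarrow>ts. 1 + edges t)"

datatype color = Black | White

text \<open>A bicolored plane tree is given by the list of the subtrees at the children
  of its root, each paired with the color of that child.\<close>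

datatype bicolored_tree = BNode "(color \<times> plane_tree) list"

fun underlying_tree :: "bicolored_tree \<Rightarrow> plane_tree" where
  "underlying_tree (BNode cts) = Node (map snd cts)"

definition bicolored_trees :: "nat \<Rightarrow> bicolored_tree set" where
  "bicolored_trees n = {b. edges (underlying_tree b) = n}"

datatype step = Up | Down

fun step_vector :: "step \<Rightarrow> int \<times> int" where
  "step_vector Up = (1, 1)"
| "step_vector Down = (1, -1)"

text \<open>A lattice path starting at the origin is encoded by its sequence of steps.\<close>

definition endpoint :: "step list \<Rightarrow> int \<times> int" where
  "endpoint p = (\<Sum>s\<leftarrow>p. step_vector s)"

definition free_dyck_paths :: "nat \<Rightarrow> step list set" where
  "free_dyck_paths n =
     {p. endpoint p = (2 * int n, 0) \<and> count_list p Up = n \<and> count_list p Down = n}"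

end

theory Submission
  imports Defs
begin

text \<open>
  Walk around the tree in depth-first order. A subtree hanging from a black child of the root is
  recorded as an excursion above the axis, with Up for descending along an edge and Down for
  returning; a subtree at a white child is recorded as an excursion below it, with the roles of
  the steps exchanged. A path returning to the axis splits uniquely into such excursions, and
  inside an excursion the step away from the axis and its matching return step delimit a subtree.
\<close>

fun flip :: "step \<Rightarrow> step" where
  "flip Up = Down"
| "flip Down = Up"

lemma flip_neq [simp]: "flip s \<noteq> s" "s \<noteq> flip s"
  by (cases s; simp)+

lemma step_cases: "x = s \<or> x = flip s"
  by (cases x; cases s) simp_all

text \<open>The argument \<open>s\<close> is the step that leads away from the axis.\<close>

fun contour :: "step \<Rightarrow> plane_tree \<Rightarrow> step list" where
  "contour s (Node []) = []"
| "contour s (Node (t # ts)) = s # contour s t @ flip s # contour s (Node ts)"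

fun color_step :: "color \<Rightarrow> step" where
  "color_step Black = Up"
| "color_step White = Down"

lemma color_step_inject [simp]: "color_step c = color_step d \<longleftrightarrow> c = d"
  by (cases c; cases d) simp_all

lemma color_step_surj: "\<exists>c. s = color_step c"
  by (metis color_step.simps step.exhaust)

fun forest_path :: "(color \<times> plane_tree) list \<Rightarrow> step list" where
  "forest_path [] = []"
| "forest_path ((c, t) # cts) =
     color_step c # contour (color_step c) t @ flip (color_step c) # forest_path cts"

fun tree_path :: "bicolored_tree \<Rightarrow> step list" where
  "tree_path (BNode cts) = forest_path cts"

text \<open>The walk crosses every edge once in each direction, so both steps occur equally
  often.\<close>

lemma count_contour: "count_list (contour s t) x = edges t"
proof (induction s t rule: contour.induct)
  case (2 s t ts)
  then show ?case
    using step_cases[of x s] by auto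
qed simp

lemma count_forest_path:
  "count_list (forest_path cts) x = edges (Node (map snd cts))"
proof (induction cts rule: forest_path.induct)
  case (2 c t cts)
  then show ?case
    using step_cases[of x "color_step c"] by (auto simp: count_contour)
qed simp

lemma endpoint_eq_counts:
  "endpoint p = (int (count_list p Up) + int (count_list p Down),
                 int (count_list p Up) - int (count_list p Down))"
proof (induction p)
  case (Cons s p)
  then show ?case
    by (cases s) (simp_all add: endpoint_def)
qed (simp add: endpoint_def zero_prod_def)

lemma free_dyck_paths_eq:
  "free_dyck_paths n = {p. count_list p Up = n \<and> count_list p Down = n}"
  by (auto simp: free_dyck_paths_def endpoint_eq_counts)

text \<open>A contour never drops below its starting level, so the \<open>flip s\<close> after it
  marks where it ends, whatever follows.\<close>

lemma contour_append_flip_inject: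
  "contour s t @ flip s # p = contour s u @ flip s # q \<longleftrightarrow> t = u \<and> p = q"
proof
  assume "contour s t @ flip s # p = contour s u @ flip s # q"
  then show "t = u \<and> p = q"
  proof (induction s t arbitrary: u p q rule: contour.induct)
    case (1 s)
    then show ?case
      by (cases "(s, u)" rule: contour.cases) auto
  next
    case (2 s t ts)
    from "2.prems" obtain u' us where u: "u = Node (u' # us)"
      by (cases "(s, u)" rule: contour.cases) auto
    \<comment> \<open>Regrouped so that the return step from the first child ends the contour of
      that child, and the outer \<open>flip s\<close> ends that of the remaining siblings.\<close>
    with "2.prems" have "contour s t @ flip s # (contour s (Node ts) @ flip s # p)
        = contour s u' @ flip s # (contour s (Node us) @ flip s # q)"
      by simp
    then have "t = u'" "contour s (Node ts) @ flip s # p = contour s (Node us) @ flip s # q"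
      using "2.IH"(1) by blast+
    with "2.IH"(2) u show ?case
      by blast
  qed
qed simp

lemma forest_path_inject: "forest_path cts = forest_path dts \<Longrightarrow> cts = dts"
proof (induction cts arbitrary: dts rule: forest_path.induct)
  case 1
  then show ?case
    by (cases dts rule: forest_path.cases) auto
next
  case (2 c t cts)
  then show ?case
    by (cases dts rule: forest_path.cases) (auto simp: contour_append_flip_inject)
qed

text \<open>A path with a surplus of return steps is cut at its first passage below the start level.\<close>

lemma first_passage:
  "count_list p s < count_list p (flip s) \<Longrightarrow> \<exists>t q. p = contour s t @ flip s # q"
proof (induction p rule: length_induct)
  case (1 p)
  then obtain x p' where p: "p = x # p'"
    by (cases p) auto
  show ?case
  proof (cases "x = s")
    case False
    then have "p = contour s (Node []) @ flip s # p'"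
      using p step_cases[of x s] by auto
    then show ?thesis
      by blast
  next
    case True
    \<comment> \<open>In fact the surplus in \<open>p'\<close> is at least two; cutting off a
      balanced contour and one return step leaves a surplus in \<open>q\<close>.\<close>
    then have "count_list p' s < count_list p' (flip s)"
      using "1.prems" p by simp
    then obtain t q where p': "p' = contour s t @ flip s # q"
      using "1.IH" p by fastforce
    then have "count_list q s < count_list q (flip s)" "length q < length p"
      using "1.prems" p True by (simp_all add: count_contour)
    then obtain u r where q: "q = contour s u @ flip s # r"
      using "1.IH" by blast
    \<comment> \<open>The first cut closes the first child \<open>t\<close>; the second yields its
      later siblings as the children of \<open>u\<close>.\<close>
    have "p = contour s (Node (t # children u)) @ flip s # r"
      using p True p' q by simp
    then show ?thesis
      by blast
  qed
qed

text \<open>The first step fixes the color. The rest has one return step too many, so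
  \<open>first_passage\<close> cuts off the first excursion and leaves a shorter balanced
  path.\<close>

lemma forest_path_surj:
  "count_list p Up = count_list p Down \<Longrightarrow> \<exists>cts. p = forest_path cts"
proof (induction p rule: length_induct)
  case (1 p)
  show ?case
  proof (cases p)
    case Nil
    then show ?thesis
      by (metis forest_path.simps(1))
  next
    case (Cons s p')
    have "count_list p' s < count_list p' (flip s)"
      using "1.prems" Cons by (cases s) simp_all
    then obtain t q where p': "p' = contour s t @ flip s # q"
      using first_passage by blast
    have "count_list q Up = count_list q Down"
      using "1.prems" Cons p' by (cases s) (simp_all add: count_contour)
    moreover have "length q < length p"
      using Cons p' by simp
    ultimately obtain cts where q: "q = forest_path cts"
      using "1.IH" by blast
    obtain c where "s = color_step c"
      using color_step_surj by blast
    then have "p = forest_path ((c, t) # cts)"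
      using Cons p' q by simp
    then show ?thesis
      by blast
  qed
qed

lemma bij_betw_tree_path: "bij_betw tree_path (bicolored_trees n) (free_dyck_paths n)"
proof (rule bij_betw_imageI)
  show "inj_on tree_path (bicolored_trees n)"
  proof (rule inj_onI)
    fix a b
    assume "tree_path a = tree_path b"
    then show "a = b"
      by (cases a; cases b) (simp add: forest_path_inject)
  qed
  show "tree_path ` bicolored_trees n = free_dyck_paths n"
  proof (intro equalityI subsetI)
    fix p
    assume "p \<in> tree_path ` bicolored_trees n"
    then obtain b where b: "p = tree_path b" "edges (underlying_tree b) = n"
      by (auto simp: bicolored_trees_def)
    then show "p \<in> free_dyck_paths n"
      by (cases b) (simp add: free_dyck_paths_eq count_forest_path del: edges.simps)
  next
    fix p
    assume p: "p \<in> free_dyck_paths n"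
    then obtain cts where cts: "p = forest_path cts"
      using forest_path_surj[of p] by (auto simp: free_dyck_paths_eq)
    then have "BNode cts \<in> bicolored_trees n"
      using p by (simp add: free_dyck_paths_eq bicolored_trees_def count_forest_path
          del: edges.simps)
    then show "p \<in> tree_path ` bicolored_trees n"
      using cts by (metis image_eqI tree_path.simps)
  qed
qed

theorem theorem2p2:
  fixes n :: nat
  shows "\<exists>f. bij_betw f (bicolored_trees n) (free_dyck_paths n)"
  using bij_betw_tree_path by blast

end
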